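(* Let $D$ be an infinite commutative unital Noetherian integral domain, and let $I$ be the ideal of weak graded identities of $D\langle X\rangle$ generated by $[y_1,y_2]=y_1y_2-y_2y_1$, $z_1z_2z_3-z_3z_2z_1$ and $y_1z_1+z_1y_1$ (equivalently, $I=Id(M_2(D),sl_2(D))$). Then every ideal of weak graded identities $J\subseteq D\langle X\rangle$ with $I\subseteq J$ is finitely generated as an ideal of weak graded identities, i.e. there is a finite set $S\subseteq J$ such that $J$ is the smallest ideal of weak graded identities containing $S$. In other words, the weak graded identities of $(M_2(D),sl_2(D))$ satisfy the Specht property.
   Context: Let $Y=\{y_1,y_2,\dots\}$ and $Z=\{z_1,z_2,\dots\}$ be disjoint countable sets of variables, $X=Y\cup Z$, and $D\langle X\rangle$ the free unital associative $D$-algebra on $X$, $\mathbb{Z}_2$-graded with the $y_i$ even and the $z_i$ odd. Let $L\langle X\rangle$ be the Lie subalgebra of $D\langle X\rangle$ (bracket $[a,b]=ab-ba$) generated by $X$, with induced grading $L\langle X\rangle^{(0)}\oplus L\langle X\rangle^{(1)}$. An ideal of weak graded identities is a two-sided ideal $J$ of $D\langle X\rangle$ closed under every algebra endomorphism of $D\langle X\rangle$ mapping each $y_i$ into $L\langle X\rangle^{(0)}$ and each $z_i$ into $L\langle X\rangle^{(1)}$; the ideal of weak graded identities generated by a set of polynomials is the smallest such ideal containing it. $M_2(D)$ is graded with diagonal matrices even and off-diagonal matrices odd; $sl_2(D)$ is the Lie algebra of traceless matrices with the induced grading; $Id(M_2(D),sl_2(D))$ is the set of polynomials vanishing under every substitution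 of each $y_i$ by an even element of $sl_2(D)$ and each $z_j$ by an odd element of $sl_2(D)$. *)

theory Defs
  imports Main
begin

definition ring_ideal :: "'a::comm_ring_1 set \<Rightarrow> bool" where
  "ring_ideal I \<longleftrightarrow> 0 \<in> I \<and> (\<forall>x\<in>I. \<forall>y\<in>I. x + y \<in> I) \<and> (\<forall>r. \<forall>x\<in>I. r * x \<in> I)"

definition noetherian :: "'a::comm_ring_1 itself \<Rightarrow> bool" where
  "noetherian _ \<longleftrightarrow> (\<forall>I::'a set. ring_ideal I \<longrightarrow>
     (\<exists>S. finite S \<and> S \<subseteq> I \<and> I = {\<Sum>s\<in>S. c s * s | c. True}))"

text \<open>Variables: even ones Y i and odd ones Z i.\<close>
datatype var = Y nat | Z nat

text \<open>Noncommutative polynomials: finitely supported functions from words to D.\<close>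
definition fpolys :: "(var list \<Rightarrow> 'd::comm_ring_1) set" where
  "fpolys = {f. finite {w. f w \<noteq> 0}}"

definition padd :: "(var list \<Rightarrow> 'd::comm_ring_1) \<Rightarrow> (var list \<Rightarrow> 'd) \<Rightarrow> var list \<Rightarrow> 'd" where
  "padd f g = (\<lambda>w. f w + g w)"

definition pneg :: "(var list \<Rightarrow> 'd::comm_ring_1) \<Rightarrow> var list \<Rightarrow> 'd" where
  "pneg f = (\<lambda>w. - f w)"

definition psub :: "(var list \<Rightarrow> 'd::comm_ring_1) \<Rightarrow> (var list \<Rightarrow> 'd) \<Rightarrow> var list \<Rightarrow> 'd" where
  "psub f g = (\<lambda>w. f w - g w)"

definition pzero :: "var list \<Rightarrow> 'd::comm_ring_1" where
  "pzero = (\<lambda>w. 0)"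

definition psmult :: "'d::comm_ring_1 \<Rightarrow> (var list \<Rightarrow> 'd) \<Rightarrow> var list \<Rightarrow> 'd" where
  "psmult c f = (\<lambda>w. c * f w)"

definition pmult :: "(var list \<Rightarrow> 'd::comm_ring_1) \<Rightarrow> (var list \<Rightarrow> 'd) \<Rightarrow> var list \<Rightarrow> 'd" where
  "pmult f g = (\<lambda>w. \<Sum>i\<le>length w. f (take i w) * g (drop i w))"

definition pone :: "var list \<Rightarrow> 'd::comm_ring_1" where
  "pone = (\<lambda>w. if w = [] then 1 else 0)"

definition pvar :: "var \<Rightarrow> var list \<Rightarrow> 'd::comm_ring_1" where
  "pvar x = (\<lambda>w. if w = [x] then 1 else 0)"

definition pcomm :: "(var list \<Rightarrow> 'd::comm_ring_1) \<Rightarrow> (var list \<Rightarrow> 'd) \<Rightarrow> var list \<Rightarrow> 'd" where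
  "pcomm a b = psub (pmult a b) (pmult b a)"

definition zcount :: "var list \<Rightarrow> nat" where
  "zcount w = length (filter (\<lambda>x. case x of Z _ \<Rightarrow> True | Y _ \<Rightarrow> False) w)"

definition homog :: "nat \<Rightarrow> (var list \<Rightarrow> 'd::comm_ring_1) \<Rightarrow> bool" where
  "homog k f \<longleftrightarrow> (\<forall>w. f w \<noteq> 0 \<longrightarrow> zcount w mod 2 = k)"

inductive_set lieX :: "(var list \<Rightarrow> 'd::comm_ring_1) set" where
  lie_var: "pvar x \<in> lieX"
| lie_add: "a \<in> lieX \<Longrightarrow> b \<in> lieX \<Longrightarrow> padd a b \<in> lieX"
| lie_smult: "a \<in> lieX \<Longrightarrow> psmult c a \<in> lieX"
| lie_bracket: "a \<in> lieX \<Longrightarrow> b \<in> lieX \<Longrightarrow> pcomm a b \<in> lieX"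

definition lieX_part :: "nat \<Rightarrow> (var list \<Rightarrow> 'd::comm_ring_1) set" where
  "lieX_part k = {f \<in> lieX. homog k f}"

definition eval_word :: "(var \<Rightarrow> (var list \<Rightarrow> 'd::comm_ring_1)) \<Rightarrow> var list \<Rightarrow> var list \<Rightarrow> 'd" where
  "eval_word \<sigma> w = foldr (\<lambda>x acc. pmult (\<sigma> x) acc) w pone"

definition psubst :: "(var \<Rightarrow> (var list \<Rightarrow> 'd::comm_ring_1)) \<Rightarrow> (var list \<Rightarrow> 'd) \<Rightarrow> var list \<Rightarrow> 'd" where
  "psubst \<sigma> f = (\<lambda>u. \<Sum>w\<in>{w. f w \<noteq> 0}. f w * eval_word \<sigma> w u)"

definition admissible :: "(var \<Rightarrow> (var list \<Rightarrow> 'd::comm_ring_1)) \<Rightarrow> bool" where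
  "admissible \<sigma> \<longleftrightarrow> (\<forall>i. \<sigma> (Y i) \<in> lieX_part 0 \<and> \<sigma> (Z i) \<in> lieX_part 1)"

definition poly_ideal :: "(var list \<Rightarrow> 'd::comm_ring_1) set \<Rightarrow> bool" where
  "poly_ideal J \<longleftrightarrow> J \<subseteq> fpolys \<and> pzero \<in> J
     \<and> (\<forall>f\<in>J. \<forall>g\<in>J. padd f g \<in> J)
     \<and> (\<forall>f\<in>J. \<forall>a\<in>fpolys. pmult a f \<in> J \<and> pmult f a \<in> J)"

definition wT_ideal :: "(var list \<Rightarrow> 'd::comm_ring_1) set \<Rightarrow> bool" where
  "wT_ideal J \<longleftrightarrow> poly_ideal J \<and> (\<forall>\<sigma>. admissible \<sigma> \<longrightarrow> (\<forall>f\<in>J. psubst \<sigma> f \<in> J))"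

definition wT_gen :: "(var list \<Rightarrow> 'd::comm_ring_1) set \<Rightarrow> (var list \<Rightarrow> 'd) set" where
  "wT_gen S = \<Inter>{J. wT_ideal J \<and> S \<subseteq> J}"

definition sl2_gens :: "(var list \<Rightarrow> 'd::comm_ring_1) set" where
  "sl2_gens = {pcomm (pvar (Y 1)) (pvar (Y 2)),
               psub (pmult (pvar (Z 1)) (pmult (pvar (Z 2)) (pvar (Z 3))))
                    (pmult (pvar (Z 3)) (pmult (pvar (Z 2)) (pvar (Z 1)))),
               padd (pmult (pvar (Y 1)) (pvar (Z 1))) (pmult (pvar (Z 1)) (pvar (Y 1)))}"

end

theory Submission
  imports Defs "HOL-Library.Sublist" "HOL-Library.Infinite_Set" "HOL-Library.Multiset_Order"
    "HOL-Library.Product_Lexorder"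
begin

text \<open>A Groebner basis argument. Modulo the relations every word is, up to sign, a normal form given
  by three multisets of indices: the even variables, and the odd variables in odd and in even
  position among the odd ones. Triples of multisets are well-ordered lexicographically, and strictly
  increasing renamings of the variables, followed by left multiplication by a word with an even
  number of odd variables, are strictly monotone for this order. By Higman's lemma the quasi-order
  on normal forms generated by these operations is a well-quasi-order; over a Noetherian ring it
  follows that the leading coefficients of an ideal \<open>J\<close> are generated by those of finitely many
  elements, and reducing leading terms shows that these elements together with the relations
  generate \<open>J\<close>. Only substitutions of variables by variables are needed.\<close>

section \<open>Well-quasi-orders\<close>

text \<open>For a preorder this is the usual notion, by the infinite Ramsey theorem.\<close>

definition wqo :: "('a \<Rightarrow> 'a \<Rightarrow> bool) \<Rightarrow> bool" where
  "wqo P \<longleftrightarrow> (\<forall>s :: nat \<Rightarrow> 'a. \<exists>k :: nat \<Rightarrow> nat. strict_mono k \<and> (\<forall>i j. i < j \<longrightarrow> P (s (k i)) (s (k j))))"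

lemma wqoD:
  assumes "wqo P"
  shows "\<exists>k :: nat \<Rightarrow> nat. strict_mono k \<and> (\<forall>i j. i < j \<longrightarrow> P (s (k i)) (s (k j)))"
  using assms unfolding wqo_def by blast

text \<open>Only finitely many indices have no later \<open>P\<close>-successor, since enumerating
  infinitely many of them would give a sequence without a good pair. Past these indices successors
  can be chosen one after another, and transitivity extends the relation from neighbours to all
  pairs.\<close>

lemma wqo_if_no_bad_sequence:
  assumes trans: "transp P" and good: "\<And>s :: nat \<Rightarrow> 'a. \<exists>i j. i < j \<and> P (s i) (s j)"
  shows "wqo P"
  unfolding wqo_def
proof
  fix s :: "nat \<Rightarrow> 'a"
  define T where "T = {n. \<forall>m>n. \<not> P (s n) (s m)}"
  have "finite T"
  proof (rule ccontr)
    assume inf: "infinite T"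
    obtain i j where "i < j" "P (s (enumerate T i)) (s (enumerate T j))"
      using good[of "\<lambda>n. s (enumerate T n)"] by blast
    moreover have "enumerate T i \<in> T" using inf by (rule enumerate_in_set)
    moreover have "enumerate T i < enumerate T j" using inf \<open>i < j\<close> by (simp add: enumerate_mono)
    ultimately show False unfolding T_def by blast
  qed
  then obtain N where N: "\<And>n. n \<in> T \<Longrightarrow> n < N"
    unfolding finite_nat_set_iff_bounded by blast
  have step: "\<exists>m. m \<ge> N \<and> (n < m \<and> P (s n) (s m))" if "n \<ge> N" for n
  proof -
    have "n \<notin> T" using N[of n] that by auto
    then obtain m where "n < m" "P (s n) (s m)" unfolding T_def by blast
    with that show ?thesis by (intro exI[of _ m]) simp
  qed
  obtain k where k: "\<And>i. k i \<ge> N" "\<And>i. k i < k (Suc i) \<and> P (s (k i)) (s (k (Suc i)))"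
    using dependent_nat_choice[of "\<lambda>_ n. n \<ge> N" "\<lambda>_ n m. n < m \<and> P (s n) (s m)"] step by auto
  have "P (s (k i)) (s (k j))" if "i < j" for i j
    using that
  proof (induction rule: less_Suc_induct)
    case (1 i) then show ?case using k by blast
  next
    case (2 i j l) then show ?case using trans by (meson transpE)
  qed
  then show "\<exists>k :: nat \<Rightarrow> nat. strict_mono k \<and> (\<forall>i j. i < j \<longrightarrow> P (s (k i)) (s (k j)))"
    using k(2) by (auto simp: strict_mono_Suc_iff)
qed

lemma wqo_nat_le: "wqo ((\<le>) :: nat \<Rightarrow> nat \<Rightarrow> bool)"
proof (rule wqo_if_no_bad_sequence)
  fix s :: "nat \<Rightarrow> nat"
  define i where "i = (ARG_MIN s n. True)"
  have "s i \<le> s (Suc i)" unfolding i_def by (rule arg_min_nat_le) simp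
  then show "\<exists>i j. i < j \<and> s i \<le> s j" by blast
qed auto

text \<open>Two of any three truth values coincide. The truth value will record whether odd and even
  positions are equally many.\<close>

lemma wqo_eq_bool: "wqo ((=) :: bool \<Rightarrow> bool \<Rightarrow> bool)"
proof (rule wqo_if_no_bad_sequence)
  fix s :: "nat \<Rightarrow> bool"
  show "\<exists>i j. i < j \<and> s i = s j"
  proof (cases "s 0 = s 1")
    case True then show ?thesis by (intro exI[of _ 0] exI[of _ 1]) simp
  next
    case False
    show ?thesis
    proof (cases "s 0 = s 2")
      case True then show ?thesis by (intro exI[of _ 0] exI[of _ 2]) simp
    next
      case False
      with \<open>s 0 \<noteq> s 1\<close> show ?thesis by (intro exI[of _ 1] exI[of _ 2]) auto
    qed
  qed
qed (auto intro: transpI)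

text \<open>A subsequence good for \<open>P\<close> is thinned out to one good for \<open>Q\<close>.
  The maps \<open>f\<close> and \<open>g\<close> let the same lemma serve for products and for
  orders pulled back along an encoding.\<close>

lemma wqo_both:
  fixes f :: "'c \<Rightarrow> 'a" and g :: "'c \<Rightarrow> 'b"
  assumes "wqo P" "wqo Q"
  shows "wqo (\<lambda>x y. P (f x) (f y) \<and> Q (g x) (g y))"
  unfolding wqo_def
proof
  fix s :: "nat \<Rightarrow> 'c"
  obtain k :: "nat \<Rightarrow> nat" where k: "strict_mono k" "\<And>i j. i < j \<Longrightarrow> P (f (s (k i))) (f (s (k j)))"
    using wqoD[OF assms(1), of "\<lambda>i. f (s i)"] by blast
  obtain l :: "nat \<Rightarrow> nat" where l: "strict_mono l" "\<And>i j. i < j \<Longrightarrow> Q (g (s (k (l i)))) (g (s (k (l j))))"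
    using wqoD[OF assms(2), of "\<lambda>i. g (s (k i))"] by blast
  have "strict_mono (\<lambda>i. k (l i))" using k(1) l(1) by (simp add: strict_mono_def)
  with k l show "\<exists>k :: nat \<Rightarrow> nat. strict_mono k \<and>
      (\<forall>i j. i < j \<longrightarrow> P (f (s (k i))) (f (s (k j))) \<and> Q (g (s (k i))) (g (s (k j))))"
    by (intro exI[of _ "\<lambda>i. k (l i)"]) (auto simp: strict_mono_def)
qed

text \<open>Higman's lemma, by the minimal bad sequence argument of Nash-Williams.\<close>

lemma wqo_list_emb:
  assumes wqo: "wqo P" and trans: "transp P"
  shows "wqo (list_emb P)"
proof (rule wqo_if_no_bad_sequence)
  show "transp (list_emb P)"
  proof (rule transpI)
    fix xs ys zs assume "list_emb P xs ys" "list_emb P ys zs"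
    then show "list_emb P xs zs" by (rule list_emb_trans[rotated]) (use trans in \<open>blast dest: transpD\<close>)
  qed
next
  fix s0 :: "nat \<Rightarrow> 'a list"
  define bad where "bad = (\<lambda>s :: nat \<Rightarrow> 'a list. \<forall>i j. i < j \<longrightarrow> \<not> list_emb P (s i) (s j))"
  \<comment> \<open>Stage \<open>n\<close> of the minimal bad sequence: \<open>r\<close> is a
    shortest \<open>n\<close>-th entry of a bad sequence that continues the entries already chosen.
    Since \<open>Q\<close> looks at \<open>f\<close> only below \<open>n\<close>,
    \<open>dependent_wellorder_choice\<close> applies.\<close>
  define Q where "Q = (\<lambda>f n r. (\<exists>s. bad s \<and> (\<forall>i<n. s i = f i) \<and> s n = r) \<and>
    (\<forall>s. bad s \<and> (\<forall>i<n. s i = f i) \<longrightarrow> length r \<le> length (s n)))"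
  show "\<exists>i j. i < j \<and> list_emb P (s0 i) (s0 j)"
  proof (rule ccontr)
    assume "\<not> ?thesis"
    then have bad0: "bad s0" by (auto simp: bad_def)
    have "\<exists>f. \<forall>n. Q f n (f n)"
    proof (rule dependent_wellorder_choice)
      fix r and f g :: "nat \<Rightarrow> 'a list" and n :: nat
      assume "\<And>i. i < n \<Longrightarrow> f i = g i"
      then show "Q f n r = Q g n r" unfolding Q_def by (simp cong: conj_cong)
    next
      fix n f assume IH: "\<And>i. i < n \<Longrightarrow> Q f i (f i)"
      have "\<exists>s. bad s \<and> (\<forall>i<n. s i = f i)"
      proof (cases n)
        case 0 then show ?thesis using bad0 by auto
      next
        case (Suc k)
        then have "Q f k (f k)" using IH by auto
        then show ?thesis unfolding Q_def Suc by (auto simp: less_Suc_eq)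
      qed
      then have ex: "\<exists>l s. bad s \<and> (\<forall>i<n. s i = f i) \<and> length (s n) = l" by blast
      define l where "l = (LEAST l. \<exists>s. bad s \<and> (\<forall>i<n. s i = f i) \<and> length (s n) = l)"
      obtain s where s: "bad s" "\<forall>i<n. s i = f i" "length (s n) = l"
        using LeastI_ex[OF ex] unfolding l_def by blast
      have "l \<le> length (t n)" if "bad t" "\<forall>i<n. t i = f i" for t
        unfolding l_def using that by (intro Least_le) blast
      with s show "\<exists>r. Q f n r" unfolding Q_def by (intro exI[of _ "s n"]) auto
    qed
    then obtain m where m: "\<And>n. Q m n (m n)" by blast
    have bad_m: "\<not> list_emb P (m i) (m j)" if "i < j" for i j
    proof -
      obtain s where "bad s" "\<forall>i<j. s i = m i" "s j = m j" using m[of j] unfolding Q_def by blast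
      then show ?thesis using that unfolding bad_def by metis
    qed
    have ne: "m n \<noteq> []" for n using bad_m[of n "Suc n"] by auto
    obtain k :: "nat \<Rightarrow> nat" where k: "strict_mono k" "\<And>i j. i < j \<Longrightarrow> P (hd (m (k i))) (hd (m (k j)))"
      using wqoD[OF wqo, of "\<lambda>n. hd (m n)"] by blast
    \<comment> \<open>The minimal bad sequence \<open>m\<close> is kept below \<open>k 0\<close> and
      continued by the tails of the entries whose heads form a \<open>P\<close>-chain. An embedding
      within \<open>t\<close> would yield one within \<open>m\<close>, so \<open>t\<close> is bad,
      yet its entry at \<open>k 0\<close> is too short.\<close>
    define t where "t = (\<lambda>i. if i < k 0 then m i else tl (m (k (i - k 0))))"
    have k0: "k 0 \<le> k i" for i using k(1) by (simp add: strict_mono_less_eq)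
    have "bad t"
      unfolding bad_def
    proof (intro allI impI notI)
      fix i j :: nat assume ij: "i < j" and emb: "list_emb P (t i) (t j)"
      consider "j < k 0" | "i < k 0" "k 0 \<le> j" | "k 0 \<le> i" using ij by linarith
      then show False
      proof cases
        case 1 then show False using emb bad_m[OF ij] ij by (simp add: t_def)
      next
        case 2
        let ?j = "k (j - k 0)"
        have "list_emb P (m i) (tl (m ?j))" using emb 2 by (simp add: t_def)
        then have "list_emb P (m i) (hd (m ?j) # tl (m ?j))" by (rule list_emb_Cons)
        then show False using bad_m[of i ?j] 2 k0[of "j - k 0"] ne by simp
      next
        case 3
        let ?i = "k (i - k 0)" and ?j = "k (j - k 0)"
        have "list_emb P (tl (m ?i)) (tl (m ?j))" using emb 3 ij by (simp add: t_def)
        moreover have "P (hd (m ?i)) (hd (m ?j))" using 3 ij by (intro k(2)) auto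
        ultimately have "list_emb P (hd (m ?i) # tl (m ?i)) (hd (m ?j) # tl (m ?j))"
          by (intro list_emb_Cons2)
        moreover have "?i < ?j" using 3 ij k(1) by (simp add: strict_mono_less)
        ultimately show False using bad_m[of ?i ?j] ne by simp
      qed
    qed
    moreover have "\<forall>i<k 0. t i = m i" by (simp add: t_def)
    ultimately have "length (m (k 0)) \<le> length (t (k 0))"
      using m[of "k 0"] unfolding Q_def by blast
    then show False using ne[of "k 0"] by (cases "m (k 0)") (simp_all add: t_def)
  qed
qed

text \<open>Past the end of \<open>xs\<close> only monotonicity is asked of \<phi>; it is total so
  that it can later rename all variables.\<close>

lemma list_emb_imp_index_map:
  assumes "list_emb P xs ys"
  shows "\<exists>\<phi> :: nat \<Rightarrow> nat. strict_mono \<phi> \<and>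
    (\<forall>i < length xs. \<phi> i < length ys \<and> P (xs ! i) (ys ! \<phi> i))"
  using assms
proof induction
  case (list_emb_Nil ys)
  then show ?case by (intro exI[of _ id]) (auto simp: strict_mono_def)
next
  case (list_emb_Cons xs ys y)
  then obtain \<phi> where "strict_mono \<phi>" "\<forall>i < length xs. \<phi> i < length ys \<and> P (xs ! i) (ys ! \<phi> i)"
    by blast
  then show ?case by (intro exI[of _ "\<lambda>i. Suc (\<phi> i)"]) (auto simp: strict_mono_def)
next
  case (list_emb_Cons2 x y xs ys)
  then obtain \<phi> where "strict_mono \<phi>" "\<forall>i < length xs. \<phi> i < length ys \<and> P (xs ! i) (ys ! \<phi> i)"
    by blast
  with list_emb_Cons2(1) show ?case
    by (intro exI[of _ "\<lambda>i. case i of 0 \<Rightarrow> 0 | Suc j \<Rightarrow> Suc (\<phi> j)"])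
      (auto simp: strict_mono_def less_Suc_eq_0_disj split: nat.splits)
qed

section \<open>Leading coefficients over a Noetherian ring\<close>

text \<open>Adding one multiple at a time makes finite dependence on generators, and the realisation
  of elements as coefficients, accessible to rule induction.\<close>

inductive_set ideal_span :: "'a::comm_ring_1 set \<Rightarrow> 'a set" for C where
  span_zero: "0 \<in> ideal_span C"
| span_step: "c \<in> C \<Longrightarrow> x \<in> ideal_span C \<Longrightarrow> r * c + x \<in> ideal_span C"

lemma ideal_span_add:
  "x \<in> ideal_span C \<Longrightarrow> y \<in> ideal_span C \<Longrightarrow> x + y \<in> ideal_span C"
  by (induction rule: ideal_span.induct) (auto simp: add.assoc intro: span_step)

lemma ideal_span_mult: "x \<in> ideal_span C \<Longrightarrow> r * x \<in> ideal_span C"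
  by (induction rule: ideal_span.induct)
    (auto simp: distrib_left mult.assoc[symmetric] intro: ideal_span.intros)

lemma ring_ideal_ideal_span: "ring_ideal (ideal_span C)"
  unfolding ring_ideal_def by (auto intro: span_zero ideal_span_add ideal_span_mult)

lemma ideal_span_superset: "c \<in> C \<Longrightarrow> c \<in> ideal_span C"
  using span_step[OF _ span_zero, of c C 1] by simp

lemma ideal_span_mono: "C \<subseteq> C' \<Longrightarrow> x \<in> ideal_span C \<Longrightarrow> x \<in> ideal_span C'"
  by (erule ideal_span.induct) (auto intro: ideal_span.intros)

lemma ideal_span_sum:
  "(\<And>s. s \<in> S \<Longrightarrow> s \<in> ideal_span C) \<Longrightarrow> (\<Sum>s\<in>S. c s * s) \<in> ideal_span C"
  by (induction S rule: infinite_finite_induct)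
    (auto intro: span_zero ideal_span_add ideal_span_mult)

text \<open>The ideal spanned by all terms has finitely many generators, each of which depends on
  finitely many terms. Some initial segment therefore spans the whole ideal, including the next
  term.\<close>

lemma noetherian_sequence:
  fixes c :: "nat \<Rightarrow> 'a::comm_ring_1"
  assumes "noetherian TYPE('a)"
  shows "\<exists>n. c n \<in> ideal_span (c ` {..<n})"
proof -
  have finite_part: "\<exists>n. x \<in> ideal_span (c ` {..<n})" if "x \<in> ideal_span (range c)" for x
    using that
  proof induction
    case span_zero
    then show ?case by (blast intro: ideal_span.span_zero)
  next
    case (span_step d x r)
    then obtain n i where "x \<in> ideal_span (c ` {..<n})" "d = c i" by blast
    then have "x \<in> ideal_span (c ` {..<max n (Suc i)})" "d \<in> c ` {..<max n (Suc i)}"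
      by (auto elim!: ideal_span_mono[rotated])
    then show ?case by (blast intro: ideal_span.span_step)
  qed
  obtain S where S: "finite S" "S \<subseteq> ideal_span (range c)"
    "ideal_span (range c) = {\<Sum>s\<in>S. d s * s | d. True}"
    using assms[unfolded noetherian_def, rule_format, OF ring_ideal_ideal_span, of "range c"] by blast
  have "\<forall>s\<in>S. \<exists>n. s \<in> ideal_span (c ` {..<n})" using S(2) finite_part by blast
  then obtain n where n: "\<And>s. s \<in> S \<Longrightarrow> s \<in> ideal_span (c ` {..<n s})" by metis
  \<comment> \<open>\<open>insert 0\<close> keeps the maximum meaningful for empty
    \<open>S\<close>.\<close>
  define N where "N = Max (insert 0 (n ` S))"
  have "s \<in> ideal_span (c ` {..<N})" if "s \<in> S" for s
  proof -
    have "n s \<le> N" unfolding N_def using S(1) that by simp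
    then show ?thesis using n[OF that] by (auto elim!: ideal_span_mono[rotated])
  qed
  moreover have "c N \<in> ideal_span (range c)" by (rule ideal_span_superset) simp
  then obtain d where "c N = (\<Sum>s\<in>S. d s * s)" using S(3) by blast
  ultimately have "c N \<in> ideal_span (c ` {..<N})" by (simp add: ideal_span_sum)
  then show ?thesis by blast
qed

text \<open>Otherwise one picks pairs whose coefficient is never generated by the earlier pairs
  below them. Along a subsequence with \<open>le\<close>-increasing first components, all earlier
  pairs do lie below, so no coefficient is in the span of its predecessors, against
  \<open>noetherian_sequence\<close>.\<close>

lemma noetherian_finite_lead_basis:
  fixes X :: "('m \<times> 'a::comm_ring_1) set"
  assumes noeth: "noetherian TYPE('a)"
    and wqo: "\<And>s :: nat \<Rightarrow> 'm. (\<And>n. s n \<in> fst ` X) \<Longrightarrow>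
      \<exists>k :: nat \<Rightarrow> nat. strict_mono k \<and> (\<forall>i j. i < j \<longrightarrow> le (s (k i)) (s (k j)))"
  shows "\<exists>F. finite F \<and> F \<subseteq> X \<and>
    (\<forall>p\<in>X. snd p \<in> ideal_span {c'. \<exists>m'. (m', c') \<in> F \<and> le m' (fst p)})"
proof (rule ccontr)
  assume neg: "\<not> ?thesis"
  define bad where "bad = (\<lambda>F p. p \<in> X \<and>
    snd p \<notin> ideal_span {c'. \<exists>m'. (m', c') \<in> F \<and> le m' (fst p)})"
  define pick where "pick = (\<lambda>F. SOME p. bad F p)"
  have pick: "bad F (pick F)" if "finite F" "F \<subseteq> X" for F
  proof -
    have "\<exists>p. bad F p"
    proof (rule ccontr)
      assume "\<nexists>p. bad F p"
      with that have "finite F \<and> F \<subseteq> X \<and>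
        (\<forall>p\<in>X. snd p \<in> ideal_span {c'. \<exists>m'. (m', c') \<in> F \<and> le m' (fst p)})"
        by (simp add: bad_def)
      then show False by (rule notE[OF neg exI[of _ F]])
    qed
    then show ?thesis unfolding pick_def by (rule someI_ex)
  qed
  define F where "F = rec_nat {} (\<lambda>_ F. insert (pick F) F)"
  have F_simps: "F 0 = {}" "F (Suc n) = insert (pick (F n)) (F n)" for n by (simp_all add: F_def)
  have F: "finite (F n) \<and> F n \<subseteq> X" for n
  proof (induction n)
    case 0 then show ?case by (simp add: F_simps)
  next
    case (Suc n)
    then have "bad (F n) (pick (F n))" using pick by blast
    with Suc show ?case by (simp add: F_simps bad_def)
  qed
  define p where "p n = pick (F n)" for n
  have p: "bad (F n) (p n)" for n using pick F unfolding p_def by blast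
  have p_in: "p i \<in> F n" if "i < n" for i n
    using that by (induction n) (auto simp: F_simps p_def less_Suc_eq)
  have "fst (p n) \<in> fst ` X" for n using p[of n] by (auto simp: bad_def)
  then obtain k :: "nat \<Rightarrow> nat" where k: "strict_mono k" "\<And>i j. i < j \<Longrightarrow> le (fst (p (k i))) (fst (p (k j)))"
    using wqo[of "\<lambda>n. fst (p n)"] by blast
  obtain n where n: "snd (p (k n)) \<in> ideal_span ((\<lambda>n. snd (p (k n))) ` {..<n})"
    using noetherian_sequence[OF noeth, of "\<lambda>n. snd (p (k n))"] by blast
  have "(\<lambda>n. snd (p (k n))) ` {..<n} \<subseteq>
      {c'. \<exists>m'. (m', c') \<in> F (k n) \<and> le m' (fst (p (k n)))}"
  proof safe
    fix i assume "i < n"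
    then have "p (k i) \<in> F (k n)" using k(1) by (intro p_in) (simp add: strict_mono_less)
    with k(2)[OF \<open>i < n\<close>] show "\<exists>m'. (m', snd (p (k i))) \<in> F (k n) \<and> le m' (fst (p (k n)))"
      by (intro exI[of _ "fst (p (k i))"]) simp
  qed
  from ideal_span_mono[OF this n] p[of "k n"] show False by (simp add: bad_def)
qed

section \<open>Words and renaming of variables\<close>

definition pword :: "var list \<Rightarrow> var list \<Rightarrow> 'd::comm_ring_1" where
  "pword w = (\<lambda>u. if u = w then 1 else 0)"

lemma pone_eq_pword: "pone = pword []"
  by (simp add: pone_def pword_def)

lemma pvar_eq_pword: "pvar x = pword [x]"
  by (simp add: pvar_def pword_def)

lemma pword_in_fpolys: "pword w \<in> fpolys"
  by (simp add: fpolys_def pword_def)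

text \<open>Of all splittings of the word only the one after \<open>u\<close> can
  contribute.\<close>

lemma pmult_pword_append: "pmult (pword u) f (u @ v) = f v"
proof -
  have "pmult (pword u) f (u @ v) =
      (\<Sum>i\<le>length (u @ v). if i = length u then f v else 0)"
    unfolding pmult_def pword_def
  proof (intro sum.cong refl)
    fix i assume "i \<in> {..length (u @ v)}"
    then have "i = length u" if "take i (u @ v) = u"
      using arg_cong[OF that, of length] by simp
    then have "take i (u @ v) = u \<longleftrightarrow> i = length u" by auto
    then show "(if take i (u @ v) = u then 1 else 0) * f (drop i (u @ v)) =
        (if i = length u then f v else 0)" by auto
  qed
  then show ?thesis by simp
qed

lemma pmult_pword_nonzero:
  assumes "pmult (pword u) f w \<noteq> 0"
  obtains v where "w = u @ v"
proof -
  obtain i where "take i w = u"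
    using assms unfolding pmult_def pword_def by (force dest: sum.not_neutral_contains_not_neutral)
  then have "w = u @ drop i w" using append_take_drop_id[of i w] by simp
  then show ?thesis by (rule that)
qed

lemma pmult_pword_pword: "pmult (pword u) (pword v) = pword (u @ v)"
proof
  fix w show "pmult (pword u) (pword v) w = pword (u @ v) w"
  proof (cases "\<exists>x. w = u @ x")
    case True
    then obtain x where "w = u @ x" by blast
    then show ?thesis by (simp add: pmult_pword_append) (simp add: pword_def)
  next
    case False
    then have "pmult (pword u) (pword v) w = 0" by (metis pmult_pword_nonzero)
    with False show ?thesis by (auto simp: pword_def)
  qed
qed

lemma pmult_psub_left: "pmult (psub f g) h = psub (pmult f h) (pmult g h)"
  by (simp add: pmult_def psub_def fun_eq_iff left_diff_distrib sum_subtractf)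

lemma pmult_psub_right: "pmult f (psub g h) = psub (pmult f g) (pmult f h)"
  by (simp add: pmult_def psub_def fun_eq_iff right_diff_distrib sum_subtractf)

lemma pmult_padd_left: "pmult (padd f g) h = padd (pmult f h) (pmult g h)"
  by (simp add: pmult_def padd_def fun_eq_iff distrib_right sum.distrib)

lemma pmult_psmult_left: "pmult (psmult c f) g = psmult c (pmult f g)"
  by (simp add: pmult_def psmult_def fun_eq_iff sum_distrib_left mult.assoc)

lemma pmult_psmult_right: "pmult f (psmult c g) = psmult c (pmult f g)"
  by (simp add: pmult_def psmult_def fun_eq_iff sum_distrib_left mult.left_commute)

fun rename :: "(nat \<Rightarrow> nat) \<Rightarrow> (nat \<Rightarrow> nat) \<Rightarrow> var \<Rightarrow> var" where
  "rename \<phi> \<psi> (Y i) = Y (\<phi> i)"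
| "rename \<phi> \<psi> (Z i) = Z (\<psi> i)"

lemma inj_rename: "inj \<phi> \<Longrightarrow> inj \<psi> \<Longrightarrow> inj (rename \<phi> \<psi>)"
  by (rule injI) (auto elim!: rename.elims dest: injD)

text \<open>Variables lie in the free Lie algebra and the renaming respects their parity. The index
  maps may identify variables, which is how the relations are later specialised to repeated
  indices.\<close>

lemma admissible_rename: "admissible (\<lambda>x. pvar (rename \<phi> \<psi> x))"
  by (auto simp: admissible_def lieX_part_def homog_def pvar_def zcount_def
      intro: lie_var[unfolded pvar_def])

lemma eval_word_rename: "eval_word (\<lambda>x. pvar (\<rho> x)) w = pword (map \<rho> w)"
  by (induction w) (simp_all add: eval_word_def pone_eq_pword pvar_eq_pword pmult_pword_pword)

lemma psubst_superset:
  assumes "finite T" "{w. f w \<noteq> 0} \<subseteq> T"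
  shows "psubst \<sigma> f u = (\<Sum>w\<in>T. f w * eval_word \<sigma> w u)"
  unfolding psubst_def using assms by (intro sum.mono_neutral_left) auto

lemma psubst_rename_map:
  assumes "f \<in> fpolys" "inj \<rho>"
  shows "psubst (\<lambda>x. pvar (\<rho> x)) f (map \<rho> w) = f w"
proof -
  have fin: "finite {w. f w \<noteq> 0}" using assms(1) by (simp add: fpolys_def)
  have "psubst (\<lambda>x. pvar (\<rho> x)) f (map \<rho> w) =
      (\<Sum>v\<in>{w. f w \<noteq> 0}. if v = w then f v else 0)"
    unfolding psubst_def eval_word_rename
    by (intro sum.cong) (auto simp: pword_def inj_map_eq_map[OF assms(2)])
  also have "\<dots> = f w" using fin by (simp add: sum.delta)
  finally show ?thesis .
qed

lemma psubst_rename_nonzero: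
  assumes "psubst (\<lambda>x. pvar (\<rho> x)) f u \<noteq> 0"
  obtains w where "u = map \<rho> w"
proof -
  obtain w where "f w * pword (map \<rho> w) u \<noteq> 0"
    using assms unfolding psubst_def eval_word_rename
    by (meson sum.not_neutral_contains_not_neutral)
  then have "u = map \<rho> w" by (auto simp: pword_def split: if_splits)
  then show ?thesis by (rule that)
qed

lemma psubst_rename_psub_pword:
  assumes "a \<noteq> b"
  shows "psubst (\<lambda>x. pvar (\<rho> x)) (psub (pword a) (pword b)) =
    psub (pword (map \<rho> a)) (pword (map \<rho> b))"
proof
  fix u
  have supp: "{w. psub (pword a) (pword b) w \<noteq> 0} \<subseteq> {a, b}" by (auto simp: psub_def pword_def)
  show "psubst (\<lambda>x. pvar (\<rho> x)) (psub (pword a) (pword b)) u =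
      psub (pword (map \<rho> a)) (pword (map \<rho> b)) u"
    using assms by (subst psubst_superset[OF _ supp]) (auto simp: eval_word_rename psub_def pword_def)
qed

lemma psubst_rename_padd_pword:
  assumes "a \<noteq> b"
  shows "psubst (\<lambda>x. pvar (\<rho> x)) (padd (pword a) (pword b)) =
    padd (pword (map \<rho> a)) (pword (map \<rho> b))"
proof
  fix u
  have supp: "{w. padd (pword a) (pword b) w \<noteq> 0} \<subseteq> {a, b}" by (auto simp: padd_def pword_def)
  show "psubst (\<lambda>x. pvar (\<rho> x)) (padd (pword a) (pword b)) u =
      padd (pword (map \<rho> a)) (pword (map \<rho> b)) u"
    using assms by (subst psubst_superset[OF _ supp]) (auto simp: eval_word_rename padd_def pword_def)
qed

section \<open>Ideals of weak graded identities\<close>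

lemma wT_ideal_fpolys: "wT_ideal K \<Longrightarrow> f \<in> K \<Longrightarrow> f \<in> fpolys"
  by (auto simp: wT_ideal_def poly_ideal_def)

lemma wT_ideal_pzero: "wT_ideal K \<Longrightarrow> pzero \<in> K"
  by (auto simp: wT_ideal_def poly_ideal_def)

lemma wT_ideal_padd: "wT_ideal K \<Longrightarrow> f \<in> K \<Longrightarrow> g \<in> K \<Longrightarrow> padd f g \<in> K"
  by (auto simp: wT_ideal_def poly_ideal_def)

lemma wT_ideal_pmult_left: "wT_ideal K \<Longrightarrow> f \<in> K \<Longrightarrow> a \<in> fpolys \<Longrightarrow> pmult a f \<in> K"
  by (auto simp: wT_ideal_def poly_ideal_def)

lemma wT_ideal_pmult_right: "wT_ideal K \<Longrightarrow> f \<in> K \<Longrightarrow> a \<in> fpolys \<Longrightarrow> pmult f a \<in> K"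
  by (auto simp: wT_ideal_def poly_ideal_def)

lemma wT_ideal_rename:
  "wT_ideal K \<Longrightarrow> f \<in> K \<Longrightarrow> psubst (\<lambda>x. pvar (rename \<phi> \<psi> x)) f \<in> K"
  unfolding wT_ideal_def using admissible_rename by blast

text \<open>Closure under scalars comes from multiplication by constant polynomials.\<close>

lemma wT_ideal_psmult:
  assumes "wT_ideal K" "f \<in> K"
  shows "psmult c f \<in> K"
proof -
  have "psmult c (pword []) \<in> fpolys"
    unfolding fpolys_def
    by (rule CollectI, rule finite_subset[of _ "{[]}"]) (auto simp: psmult_def pword_def)
  moreover have "pmult (psmult c (pword [])) f = psmult c f"
    unfolding pmult_psmult_left using pmult_pword_append[of "[]" f] by (simp add: psmult_def)
  ultimately show ?thesis using wT_ideal_pmult_left[OF assms] by metis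
qed

lemma wT_ideal_psub:
  assumes "wT_ideal K" "f \<in> K" "g \<in> K"
  shows "psub f g \<in> K"
proof -
  have "psub f g = padd f (psmult (-1) g)" by (simp add: psub_def padd_def psmult_def)
  then show ?thesis using assms by (simp add: wT_ideal_padd wT_ideal_psmult)
qed

lemma wT_ideal_sum:
  assumes "wT_ideal K" "\<And>i. i \<in> A \<Longrightarrow> g i \<in> K"
  shows "(\<lambda>u. \<Sum>i\<in>A. c i * g i u) \<in> K"
  using assms(2)
proof (induction A rule: infinite_finite_induct)
  case (insert i A)
  then have "padd (psmult (c i) (g i)) (\<lambda>u. \<Sum>i\<in>A. c i * g i u) \<in> K"
    using assms(1) by (intro wT_ideal_padd wT_ideal_psmult) auto
  with insert show ?case by (simp add: padd_def psmult_def)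
qed (use wT_ideal_pzero[OF assms(1)] in \<open>simp_all add: pzero_def\<close>)

lemma wT_gen_subset: "wT_ideal J \<Longrightarrow> S \<subseteq> J \<Longrightarrow> wT_gen S \<subseteq> J"
  unfolding wT_gen_def by blast

lemma wT_gen_superset: "S \<subseteq> wT_gen S"
  unfolding wT_gen_def by blast

text \<open>The ideal \<open>J\<close> shows that the intersected family is non-empty, which
  confines the intersection to finitely supported functions.\<close>

lemma wT_ideal_wT_gen:
  assumes "wT_ideal J" "S \<subseteq> J"
  shows "wT_ideal (wT_gen S)"
proof -
  have "wT_gen S \<subseteq> fpolys"
    using wT_gen_subset[OF assms] wT_ideal_fpolys[OF assms(1)] by blast
  then show ?thesis unfolding wT_gen_def wT_ideal_def poly_ideal_def by blast
qed

section \<open>Normal forms of words\<close>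

fun ypart :: "var list \<Rightarrow> nat multiset" where
  "ypart [] = {#}"
| "ypart (Y i # w) = add_mset i (ypart w)"
| "ypart (Z i # w) = ypart w"

text \<open>Positions are counted among the odd letters only, so an odd letter in front exchanges
  the two parities. The relation \<open>z1 z2 z3 = z3 z2 z1\<close> permutes odd letters within
  positions of equal parity, which leaves these two multisets invariant.\<close>

fun zodd :: "var list \<Rightarrow> nat multiset" and zeven :: "var list \<Rightarrow> nat multiset" where
  "zodd [] = {#}"
| "zodd (Y i # w) = zodd w"
| "zodd (Z i # w) = add_mset i (zeven w)"
| "zeven [] = {#}"
| "zeven (Y i # w) = zeven w"
| "zeven (Z i # w) = zodd w"

type_synonym code = "nat multiset \<times> nat multiset \<times> nat multiset"

definition code :: "var list \<Rightarrow> code" where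
  "code w = (ypart w, zodd w, zeven w)"

text \<open>Since \<open>y z = - z y\<close>, moving all even letters to the front costs one sign
  for each pair of an odd letter left of an even one.\<close>

fun wsign :: "var list \<Rightarrow> 'd::comm_ring_1" where
  "wsign [] = 1"
| "wsign (Y i # w) = wsign w"
| "wsign (Z i # w) = (- 1) ^ size (ypart w) * wsign w"

lemma wsign_square [simp]: "wsign w * wsign w = (1 :: 'd::comm_ring_1)"
proof (induction w)
  case (Cons x w)
  have "((- 1) ^ n * s) * ((- 1) ^ n * s) = s * s" for n and s :: 'd
    by (simp add: mult.left_commute mult.assoc flip: power_mult_distrib mult.assoc[of "(-1) ^ n"])
  with Cons show ?case by (cases x) simp_all
qed simp

lemma size_zodd: "size (zodd w) = size (zeven w) \<or> size (zodd w) = Suc (size (zeven w))"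
proof (induction w)
  case (Cons x w) then show ?case by (cases x) auto
qed simp

lemma length_eq_size_code: "length w = size (ypart w) + size (zodd w) + size (zeven w)"
proof (induction w)
  case (Cons x w) then show ?case by (cases x) auto
qed simp

lemma set_eq_set_code:
  "set w = Y ` set_mset (ypart w) \<union> Z ` (set_mset (zodd w) \<union> set_mset (zeven w))"
proof (induction w)
  case (Cons x w) then show ?case by (cases x) auto
qed simp

text \<open>The code fixes both the length of a word and the finite set of its letters. Sums over
  all words of a given code are thus finite.\<close>

lemma finite_code_fibre: "finite {w. code w = m}"
proof -
  obtain a b c where m: "m = (a, b, c)" by (cases m)
  have "{w. code w = m} \<subseteq> {w. set w \<subseteq> Y ` set_mset a \<union> Z ` (set_mset b \<union> set_mset c) \<and>
      length w = size a + size b + size c}"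
    using set_eq_set_code length_eq_size_code by (auto simp: m code_def)
  then show ?thesis by (rule finite_subset) (intro finite_lists_length_eq, simp)
qed

lemma code_Cons_cong: "code w = code w' \<Longrightarrow> code (x # w) = code (x # w')"
  by (cases x) (auto simp: code_def)

lemma code_Cons_inject: "code (x # w) = code (x # w') \<Longrightarrow> code w = code w'"
  by (cases x) (auto simp: code_def)

text \<open>The sign is built in so that signed words of equal code agree modulo the
  relations.\<close>

definition sword :: "var list \<Rightarrow> var list \<Rightarrow> 'd::comm_ring_1" where
  "sword w = psmult (wsign w) (pword w)"

text \<open>The sign contributed by a new first letter depends only on the number of even letters
  behind it, hence only on the code; one factor \<open>e\<close> serves both words.\<close>

lemma sword_Cons:
  assumes "code w = code w'"
  obtains e :: "'d::comm_ring_1" where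
    "sword (x # w) = psmult e (pmult (pword [x]) (sword w))"
    "sword (x # w') = psmult e (pmult (pword [x]) (sword w'))"
proof (cases x)
  case (Y i)
  then show ?thesis
    by (intro that[of 1]; simp add: sword_def pmult_psmult_right pmult_pword_pword)
      (simp_all add: psmult_def)
next
  case (Z i)
  have "ypart w' = ypart w" using assms by (simp add: code_def)
  with Z show ?thesis
    by (intro that[of "(- 1) ^ size (ypart w)"];
        simp add: sword_def pmult_psmult_right pmult_pword_pword)
      (simp_all add: psmult_def mult.assoc)
qed

section \<open>Congruence of words modulo the relations\<close>

locale sl2_identities =
  fixes K :: "(var list \<Rightarrow> 'd::comm_ring_1) set"
  assumes wT_ideal: "wT_ideal K" and gens: "sl2_gens \<subseteq> K"
begin

lemma YY_relation: "psub (pword [Y i, Y j]) (pword [Y j, Y i]) \<in> K"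
proof -
  have "psub (pword [Y 1, Y 2]) (pword [Y 2, Y 1]) \<in> K"
    using gens by (simp add: sl2_gens_def pcomm_def pvar_eq_pword pmult_pword_pword)
  from wT_ideal_rename[OF wT_ideal this, of "\<lambda>n. if n = 1 then i else j" id]
  show ?thesis by (simp add: psubst_rename_psub_pword)
qed

lemma ZZZ_relation: "psub (pword [Z i, Z j, Z k]) (pword [Z k, Z j, Z i]) \<in> K"
proof -
  have "psub (pword [Z 1, Z 2, Z 3]) (pword [Z 3, Z 2, Z 1]) \<in> K"
    using gens by (simp add: sl2_gens_def pvar_eq_pword pmult_pword_pword)
  from wT_ideal_rename[OF wT_ideal this, of id "\<lambda>n. if n = 1 then i else if n = 2 then j else k"]
  show ?thesis by (simp add: psubst_rename_psub_pword)
qed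

lemma YZ_relation: "padd (pword [Y i, Z j]) (pword [Z j, Y i]) \<in> K"
proof -
  have "padd (pword [Y 1, Z 1]) (pword [Z 1, Y 1]) \<in> K"
    using gens by (simp add: sl2_gens_def pvar_eq_pword pmult_pword_pword)
  from wT_ideal_rename[OF wT_ideal this, of "\<lambda>_. i" "\<lambda>_. j"]
  show ?thesis by (simp add: psubst_rename_padd_pword)
qed

text \<open>Equality of codes is carried along because the sign acquired by prefixing a letter
  depends on the code.\<close>

definition wcong :: "var list \<Rightarrow> var list \<Rightarrow> bool" where
  "wcong w w' \<longleftrightarrow> code w = code w' \<and> psub (sword w) (sword w') \<in> K"

lemma wcong_refl: "wcong w w"
  using wT_ideal_pzero[OF wT_ideal] by (simp add: wcong_def psub_def pzero_def)

lemma wcong_sym: "wcong w w' \<Longrightarrow> wcong w' w"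
  using wT_ideal_psmult[OF wT_ideal, of "psub (sword w) (sword w')" "-1"]
  by (auto simp: wcong_def psub_def psmult_def)

lemma wcong_trans [trans]: "wcong u v \<Longrightarrow> wcong v w \<Longrightarrow> wcong u w"
  using wT_ideal_padd[OF wT_ideal, of "psub (sword u) (sword v)" "psub (sword v) (sword w)"]
  by (auto simp: wcong_def psub_def padd_def)

lemma wcong_Cons:
  assumes "wcong w w'"
  shows "wcong (x # w) (x # w')"
proof -
  have code: "code w = code w'" and K: "psub (sword w) (sword w') \<in> K"
    using assms by (auto simp: wcong_def)
  obtain e :: 'd where e: "sword (x # w) = psmult e (pmult (pword [x]) (sword w))"
    "sword (x # w') = psmult e (pmult (pword [x]) (sword w'))"
    using sword_Cons[OF code] by blast
  have "psmult e (pmult (pword [x]) (psub (sword w) (sword w'))) \<in> K"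
    using K wT_ideal by (intro wT_ideal_psmult wT_ideal_pmult_left pword_in_fpolys)
  moreover have "psmult e (pmult (pword [x]) (psub (sword w) (sword w'))) =
      psub (sword (x # w)) (sword (x # w'))"
    unfolding e pmult_psub_right by (simp add: psmult_def psub_def right_diff_distrib)
  ultimately show ?thesis using code_Cons_cong[OF code] by (simp add: wcong_def)
qed

lemma wcong_if_relation:
  assumes "psub (pword a) (pword b) \<in> K" "code (a @ v) = code (b @ v)"
    "wsign (a @ v) = (wsign (b @ v) :: 'd)"
  shows "wcong (a @ v) (b @ v)"
proof -
  have "psmult (wsign (b @ v) :: 'd) (pmult (psub (pword a) (pword b)) (pword v)) \<in> K"
    using assms(1) wT_ideal by (intro wT_ideal_psmult wT_ideal_pmult_right pword_in_fpolys)
  moreover have "psmult (wsign (b @ v) :: 'd) (pmult (psub (pword a) (pword b)) (pword v)) =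
      psub (sword (a @ v)) (sword (b @ v))"
    unfolding sword_def pmult_psub_left pmult_pword_pword
    by (simp add: assms(3) psmult_def psub_def right_diff_distrib)
  ultimately show ?thesis using assms(2) by (simp add: wcong_def)
qed

lemma wcong_YY: "wcong (Y i # Y j # v) (Y j # Y i # v)"
  using wcong_if_relation[OF YY_relation[of i j], of v] by (simp add: code_def)

lemma wcong_ZZZ: "wcong (Z i # Z j # Z k # v) (Z k # Z j # Z i # v)"
  using wcong_if_relation[OF ZZZ_relation[of i j k], of v] by (simp add: code_def)

text \<open>The exchange flips \<open>wsign\<close>, so the sum in the relation becomes a difference
  of signed words.\<close>

lemma wcong_YZ: "wcong (Y i # Z j # v) (Z j # Y i # v)"
proof -
  let ?s = "wsign (Y i # Z j # v) :: 'd"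
  have "psmult ?s (pmult (padd (pword [Y i, Z j]) (pword [Z j, Y i])) (pword v)) \<in> K"
    using YZ_relation wT_ideal by (intro wT_ideal_psmult wT_ideal_pmult_right pword_in_fpolys)
  moreover have "psmult ?s (pmult (padd (pword [Y i, Z j]) (pword [Z j, Y i])) (pword v)) =
      psub (sword (Y i # Z j # v)) (sword (Z j # Y i # v))"
    unfolding sword_def pmult_padd_left pmult_pword_pword
    by (simp add: psmult_def psub_def padd_def fun_eq_iff distrib_left)
  ultimately show ?thesis by (simp add: wcong_def code_def)
qed

lemma wcong_pull_Y:
  "Y i \<in> set w \<Longrightarrow> \<exists>v. wcong w (Y i # v)"
proof (induction w)
  case (Cons x w)
  show ?case
  proof (cases "x = Y i")
    case True then show ?thesis using wcong_refl by blast
  next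
    case False
    with Cons obtain v where "wcong w (Y i # v)" by auto
    then have "wcong (x # w) (x # Y i # v)" by (rule wcong_Cons)
    also have "wcong (x # Y i # v) (Y i # x # v)"
      by (cases x) (auto intro: wcong_YY wcong_sym[OF wcong_YZ])
    finally show ?thesis by blast
  qed
qed simp

text \<open>Both parities need a common induction, as a new odd letter exchanges them. A letter in
  even position gets only to second place; behind a further odd letter it is third, and
  \<open>wcong_ZZZ\<close> brings it to the front.\<close>

lemma wcong_pull_Z:
  "(k \<in># zodd w \<longrightarrow> (\<exists>v. wcong w (Z k # v))) \<and>
   (k \<in># zeven w \<longrightarrow> (\<exists>j v. wcong w (Z j # Z k # v)))"
proof (induction w)
  case (Cons x w)
  show ?case
  proof (cases x)
    case (Y i)
    have "\<exists>v. wcong (x # w) (Z k # v)" if odd: "k \<in># zodd w"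
    proof -
      obtain v where "wcong w (Z k # v)" using Cons odd by blast
      then have "wcong (x # w) (Y i # Z k # v)" unfolding Y by (rule wcong_Cons)
      also have "wcong (Y i # Z k # v) (Z k # Y i # v)" by (rule wcong_YZ)
      finally show ?thesis by blast
    qed
    moreover have "\<exists>j v. wcong (x # w) (Z j # Z k # v)" if even: "k \<in># zeven w"
    proof -
      obtain j v where "wcong w (Z j # Z k # v)" using Cons even by blast
      then have "wcong (x # w) (Y i # Z j # Z k # v)" unfolding Y by (rule wcong_Cons)
      also have "wcong (Y i # Z j # Z k # v) (Z j # Y i # Z k # v)" by (rule wcong_YZ)
      also have "wcong (Z j # Y i # Z k # v) (Z j # Z k # Y i # v)" by (rule wcong_Cons[OF wcong_YZ])
      finally show ?thesis by blast
    qed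
    ultimately show ?thesis using Y by simp
  next
    case (Z i)
    have "\<exists>v. wcong (x # w) (Z k # v)" if even: "k \<in># zeven w"
    proof -
      obtain j v where "wcong w (Z j # Z k # v)" using Cons even by blast
      then have "wcong (x # w) (Z i # Z j # Z k # v)" unfolding Z by (rule wcong_Cons)
      also have "wcong (Z i # Z j # Z k # v) (Z k # Z j # Z i # v)" by (rule wcong_ZZZ)
      finally show ?thesis by blast
    qed
    moreover have "\<exists>j v. wcong (x # w) (Z j # Z k # v)" if odd: "k \<in># zodd w"
    proof -
      obtain v where "wcong w (Z k # v)" using Cons odd by blast
      then have "wcong (x # w) (Z i # Z k # v)" unfolding Z by (rule wcong_Cons)
      then show ?thesis by blast
    qed
    ultimately show ?thesis using Z wcong_refl by auto
  qed
qed simp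

text \<open>The first letter of one word can be pulled to the front of the other. The remainders
  again have equal codes, and induction applies.\<close>

lemma wcong_if_code_eq: "code w = code w' \<Longrightarrow> wcong w w'"
proof (induction w arbitrary: w')
  case Nil
  then have "length w' = 0" using length_eq_size_code[of w'] by (simp add: code_def)
  then show ?case using wcong_refl by simp
next
  case (Cons x w)
  have "\<exists>v. wcong w' (x # v)"
  proof (cases x)
    case (Y i)
    then have "ypart w' = add_mset i (ypart w)" using Cons.prems by (simp add: code_def)
    then have "i \<in># ypart w'" by simp
    then have "Y i \<in> set w'" by (simp add: set_eq_set_code[of w'])
    then show ?thesis using wcong_pull_Y Y by blast
  next
    case (Z i)
    then have "zodd w' = add_mset i (zeven w)" using Cons.prems by (simp add: code_def)
    then have "i \<in># zodd w'" by simp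
    then show ?thesis using wcong_pull_Z Z by blast
  qed
  then obtain v where v: "wcong w' (x # v)" by blast
  then have "code (x # w) = code (x # v)" using Cons.prems by (simp add: wcong_def)
  then have "wcong w v" by (rule Cons.IH[OF code_Cons_inject])
  then have "wcong (x # w) (x # v)" by (rule wcong_Cons)
  then show ?case using v by (blast intro: wcong_trans wcong_sym)
qed

end

text \<open>Replacing each word of \<open>f\<close> by the signed representative of its code
  collects exactly this coefficient at \<open>m\<close>.\<close>

definition nf_coeff :: "(var list \<Rightarrow> 'd::comm_ring_1) \<Rightarrow> code \<Rightarrow> 'd" where
  "nf_coeff f m = (\<Sum>w | code w = m. wsign w * f w)"

lemma nf_coeff_padd: "nf_coeff (padd f g) m = nf_coeff f m + nf_coeff g m"
  by (simp add: nf_coeff_def padd_def distrib_left sum.distrib)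

lemma nf_coeff_psub: "nf_coeff (psub f g) m = nf_coeff f m - nf_coeff g m"
  by (simp add: nf_coeff_def psub_def right_diff_distrib sum_subtractf)

lemma nf_coeff_psmult: "nf_coeff (psmult c f) m = c * nf_coeff f m"
  by (simp add: nf_coeff_def psmult_def sum_distrib_left mult.left_commute)

lemma nf_coeff_pzero: "nf_coeff pzero m = 0"
  by (simp add: nf_coeff_def pzero_def)

lemma nf_coeff_nonzero:
  assumes "nf_coeff f m \<noteq> 0"
  obtains w where "code w = m" "f w \<noteq> 0"
  using assms unfolding nf_coeff_def by (force dest: sum.not_neutral_contains_not_neutral)

text \<open>Modulo \<open>K\<close> every signed word equals the signed representative
  \<open>rep\<close> of its code. Collecting terms by code leaves the representatives with
  coefficients \<open>nf_coeff f m\<close>, all zero.\<close>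

lemma (in sl2_identities) mem_if_nf_coeff_zero:
  assumes f: "f \<in> fpolys" and zero: "\<And>m. nf_coeff f m = 0"
  shows "f \<in> K"
proof -
  define A where "A = {w. f w \<noteq> 0}"
  define rep where "rep m = (SOME w. code w = m)" for m
  have rep: "code (rep (code w)) = code w" for w
    unfolding rep_def by (rule someI) (rule refl)
  have fin: "finite A" using f by (simp add: A_def fpolys_def)
  \<comment> \<open>The factor \<open>wsign w\<close> cancels the sign inside
    \<open>sword w\<close>, because signs square to one; the first halves of the differences thus
    add up to \<open>f\<close>.\<close>
  have "(\<lambda>u. \<Sum>w\<in>A. (f w * wsign w) * psub (sword w) (sword (rep (code w))) u) \<in> K"
    using wT_ideal wcong_if_code_eq[OF rep[symmetric]] by (intro wT_ideal_sum) (auto simp: wcong_def)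
  moreover have "(\<Sum>w\<in>A. (f w * wsign w) * psub (sword w) (sword (rep (code w))) u) = f u" for u
  proof -
    have "(\<Sum>w\<in>A. (f w * wsign w) * sword w u) = (\<Sum>w\<in>A. if w = u then f w else 0)"
      by (intro sum.cong) (auto simp: sword_def psmult_def pword_def mult.assoc)
    also have "\<dots> = f u" using fin by (simp add: A_def)
    finally have 1: "(\<Sum>w\<in>A. (f w * wsign w) * sword w u) = f u" .
    have "(\<Sum>w\<in>A. (f w * wsign w) * sword (rep (code w)) u) =
        (\<Sum>m\<in>code ` A. \<Sum>w | w \<in> A \<and> code w = m. (f w * wsign w) * sword (rep (code w)) u)"
      using fin by (rule sum.image_gen)
    also have "\<dots> = (\<Sum>m\<in>code ` A. nf_coeff f m * sword (rep m) u)"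
    proof (intro sum.cong refl)
      fix m
      have "(\<Sum>w | w \<in> A \<and> code w = m. (f w * wsign w) * sword (rep (code w)) u) =
          (\<Sum>w | w \<in> A \<and> code w = m. wsign w * f w) * sword (rep m) u"
        unfolding sum_distrib_right by (intro sum.cong) (auto simp: mult.commute)
      also have "(\<Sum>w | w \<in> A \<and> code w = m. wsign w * f w) = nf_coeff f m"
        unfolding nf_coeff_def by (rule sum.mono_neutral_left) (auto simp: A_def finite_code_fibre)
      finally show "(\<Sum>w | w \<in> A \<and> code w = m. (f w * wsign w) * sword (rep (code w)) u) =
          nf_coeff f m * sword (rep m) u" .
    qed
    also have "\<dots> = 0" by (simp add: zero)
    finally show ?thesis using 1 by (simp add: psub_def right_diff_distrib sum_subtractf)
  qed
  ultimately show ?thesis by simp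
qed

section \<open>Embedding of normal forms\<close>

fun shift :: "(nat \<Rightarrow> nat) \<Rightarrow> code \<Rightarrow> code \<Rightarrow> code" where
  "shift \<phi> (p, q, r) (a, b, c) = (p + image_mset \<phi> a, q + image_mset \<phi> b, r + image_mset \<phi> c)"

text \<open>The condition that \<open>q\<close> and \<open>r\<close> have equal size makes the shift realisable by multiplication from
  the left with pairs of odd variables, which does not exchange odd and even positions.\<close>

definition code_emb :: "code \<Rightarrow> code \<Rightarrow> bool" where
  "code_emb m m' \<longleftrightarrow> (\<exists>\<phi> p q r. strict_mono \<phi> \<and> size q = size r \<and> m' = shift \<phi> (p, q, r) m)"

lemma image_mset_strict_mono:
  fixes \<phi> :: "nat \<Rightarrow> nat"
  assumes "strict_mono \<phi>" "a < b"
  shows "image_mset \<phi> a < image_mset \<phi> b"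
  using assms multp_image_mset_image_msetI[of "(<)" \<phi> a b]
  by (simp add: less_multiset_def strict_mono_less)

text \<open>This makes shifts carry leading codes to leading codes: in each component, strictly
  increasing renaming and addition of a fixed multiset preserve the multiset order, and the
  lexicographic order follows.\<close>

lemma shift_strict_mono:
  assumes "strict_mono \<phi>"
  shows "strict_mono (shift \<phi> t)"
proof (rule strict_monoI)
  fix m m' :: code
  assume "m < m'"
  moreover obtain p q r a b c a' b' c' where "t = (p, q, r)" "m = (a, b, c)" "m' = (a', b', c')"
    by (cases t, cases m, cases m') blast
  \<comment> \<open>Injectivity follows from strict monotonicity because multisets of naturals are
    linearly ordered.\<close>
  moreover have "image_mset \<phi> x = image_mset \<phi> y \<longleftrightarrow> x = y" for x y
    using image_mset_strict_mono[OF assms] by (metis less_irrefl neqE)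
  ultimately show "shift \<phi> t m < shift \<phi> t m'"
    by (auto simp: less_prod_def' le_less image_mset_strict_mono[OF assms])
qed

lemma code_map_rename:
  "ypart (map (rename \<phi> \<phi>) w) = image_mset \<phi> (ypart w)"
  "zodd (map (rename \<phi> \<phi>) w) = image_mset \<phi> (zodd w)"
  "zeven (map (rename \<phi> \<phi>) w) = image_mset \<phi> (zeven w)"
proof (induction w)
  case (Cons x w)
  { case 1 show ?case using Cons by (cases x) simp_all }
  { case 2 show ?case using Cons by (cases x) simp_all }
  { case 3 show ?case using Cons by (cases x) simp_all }
qed simp_all

lemma wsign_map_rename: "wsign (map (rename \<phi> \<phi>) w) = wsign w"
proof (induction w)
  case (Cons x w) then show ?case by (cases x) (simp_all add: code_map_rename)
qed simp

text \<open>Even letters placed first cost no sign. The two letters of an odd pair see equally many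
  even letters behind them, so their signs cancel, and the pair preserves the parity of later
  positions.\<close>

lemma ex_prefix_word:
  assumes "size q = size r"
  shows "\<exists>u. \<forall>w. code (u @ w) = (p + ypart w, q + zodd w, r + zeven w) \<and>
    wsign (u @ w) = (wsign w :: 'd::comm_ring_1)"
  using assms
proof (induction p)
  case empty
  then show ?case
  proof (induction q arbitrary: r)
    case empty
    then show ?case by (intro exI[of _ "[]"]) (simp add: code_def)
  next
    case (add i q)
    then obtain j r' where r: "r = add_mset j r'" by (metis size_eq_Suc_imp_eq_union size_add_mset)
    with add obtain u where u: "\<forall>w. code (u @ w) = ({#} + ypart w, q + zodd w, r' + zeven w) \<and>
      wsign (u @ w) = (wsign w :: 'd)" by auto
    then show ?case
      by (intro exI[of _ "Z i # Z j # u"])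
        (simp add: r code_def flip: mult.assoc power_mult_distrib)
  qed
next
  case (add i p)
  then obtain u where "\<forall>w. code (u @ w) = (p + ypart w, q + zodd w, r + zeven w) \<and>
      wsign (u @ w) = (wsign w :: 'd)" by auto
  then show ?case by (intro exI[of _ "Y i # u"]) (simp add: code_def)
qed

text \<open>Renaming followed by left multiplication with a prefix acts injectively on words, keeps
  signs, and moves codes by the strictly increasing map \<open>H\<close>. Coefficients are therefore
  transported along \<open>H\<close>, and those outside its range vanish.\<close>

lemma wT_ideal_code_emb:
  fixes f :: "var list \<Rightarrow> 'd::comm_ring_1"
  assumes K: "wT_ideal K" "f \<in> K" and emb: "code_emb m m'"
    and lead: "\<And>n. n > m \<Longrightarrow> nf_coeff f n = 0"
  obtains g where "g \<in> K" "nf_coeff g m' = nf_coeff f m" "\<And>n. n > m' \<Longrightarrow> nf_coeff g n = 0"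
proof -
  obtain \<phi> p q r where \<phi>: "strict_mono \<phi>" and sz: "size q = size r"
    and m': "m' = shift \<phi> (p, q, r) m" using emb unfolding code_emb_def by blast
  define H where "H = shift \<phi> (p, q, r)"
  have H: "strict_mono H" unfolding H_def using \<phi> by (rule shift_strict_mono)
  obtain u where u: "\<And>w. code (u @ w) = (p + ypart w, q + zodd w, r + zeven w)"
    "\<And>w. wsign (u @ w) = (wsign w :: 'd)" using ex_prefix_word[OF sz] by blast
  define \<rho> where "\<rho> = rename \<phi> \<phi>"
  define h where "h w = u @ map \<rho> w" for w
  have inj_\<rho>: "inj \<rho>"
    unfolding \<rho>_def using \<phi> by (intro inj_rename) (auto intro: strict_mono_imp_inj_on)
  then have inj_h: "inj h" by (intro injI) (auto simp: h_def inj_map_eq_map)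
  have code_h: "code (h w) = H (code w)" for w
    by (simp add: h_def u \<rho>_def code_map_rename H_def) (simp add: code_def)
  have wsign_h: "wsign (h w) = (wsign w :: 'd)" for w
    by (simp add: h_def u \<rho>_def wsign_map_rename)
  define g where "g = pmult (pword u) (psubst (\<lambda>x. pvar (\<rho> x)) f)"
  have g_h: "g (h w) = f w" for w
    by (simp add: g_def h_def pmult_pword_append psubst_rename_map inj_\<rho> wT_ideal_fpolys[OF K])
  have g_range: "w \<in> range h" if gw: "g w \<noteq> 0" for w
  proof -
    obtain v where v: "w = u @ v" using gw[unfolded g_def] by (rule pmult_pword_nonzero)
    then have "psubst (\<lambda>x. pvar (\<rho> x)) f v \<noteq> 0" using gw by (simp add: g_def pmult_pword_append)
    then obtain w' where "v = map \<rho> w'" by (rule psubst_rename_nonzero)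
    with v show ?thesis by (auto simp: h_def)
  qed
  have coeff: "nf_coeff g (H n) = nf_coeff f n" for n
  proof -
    \<comment> \<open>As \<open>H\<close> is injective, words of code \<open>H n\<close> in the
      support of \<open>g\<close> come only from words of code \<open>n\<close>.\<close>
    have "nf_coeff g (H n) = (\<Sum>w \<in> h ` {w. code w = n}. wsign w * g w)"
      unfolding nf_coeff_def
    proof (rule sum.mono_neutral_right)
      show "\<forall>w \<in> {w. code w = H n} - h ` {w. code w = n}. wsign w * g w = 0"
      proof (intro ballI, rule ccontr)
        fix w assume w: "w \<in> {w. code w = H n} - h ` {w. code w = n}" and "wsign w * g w \<noteq> 0"
        then have "g w \<noteq> 0" by auto
        then obtain v where "w = h v" using g_range by blast
        with w show False using strict_mono_eq[OF H] by (auto simp: code_h)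
      qed
    qed (auto simp: code_h finite_code_fibre)
    also have "\<dots> = nf_coeff f n"
      unfolding nf_coeff_def using inj_h
      by (subst sum.reindex) (auto simp: wsign_h g_h intro: inj_on_subset)
    finally show ?thesis .
  qed
  show ?thesis
  proof (rule that)
    show "g \<in> K" unfolding g_def \<rho>_def
      using K by (intro wT_ideal_pmult_left wT_ideal_rename pword_in_fpolys)
    show "nf_coeff g m' = nf_coeff f m" using coeff by (simp add: m' H_def)
    show "nf_coeff g n = 0" if "n > m'" for n
    proof (rule ccontr)
      assume "nf_coeff g n \<noteq> 0"
      then obtain w where "code w = n" "g w \<noteq> 0" by (rule nf_coeff_nonzero)
      then obtain v where v: "n = H (code v)" using g_range code_h by blast
      with that have "code v > m" using strict_mono_less[OF H] by (simp add: m' H_def)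
      with lead coeff v \<open>nf_coeff g n \<noteq> 0\<close> show False by simp
    qed
  qed
qed

section \<open>Well-quasi-ordering of the codes of words\<close>

definition counts_le :: "nat \<times> nat \<times> nat \<Rightarrow> nat \<times> nat \<times> nat \<Rightarrow> bool" where
  "counts_le x y \<longleftrightarrow> fst x \<le> fst y \<and> fst (snd x) \<le> fst (snd y) \<and> snd (snd x) \<le> snd (snd y)"

lemma wqo_counts_le: "wqo counts_le"
  unfolding counts_le_def by (intro wqo_both wqo_nat_le)

fun counts :: "code \<Rightarrow> nat \<Rightarrow> nat \<times> nat \<times> nat" where
  "counts (a, b, c) i = (count a i, count b i, count c i)"

definition code_bound :: "code \<Rightarrow> nat" where
  "code_bound m = (LEAST n. \<forall>i\<ge>n. counts m i = (0, 0, 0))"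

lemma counts_beyond_bound:
  assumes "i \<ge> code_bound m"
  shows "counts m i = (0, 0, 0)"
proof -
  obtain a b c where m: "m = (a, b, c)" by (cases m)
  obtain n where "\<forall>i \<in> set_mset a \<union> set_mset b \<union> set_mset c. i < n"
    using finite_nat_set_iff_bounded by (metis finite_UnI finite_set_mset)
  then have "i \<notin># a \<and> i \<notin># b \<and> i \<notin># c" if "i \<ge> n" for i
    using that by (meson UnI1 UnI2 leD)
  then have "\<forall>i\<ge>n. counts m i = (0, 0, 0)" by (simp add: m not_in_iff)
  then have "\<forall>i\<ge>code_bound m. counts m i = (0, 0, 0)"
    unfolding code_bound_def by (rule LeastI)
  with assms show ?thesis by blast
qed

text \<open>Indices with zero counts keep their place in the list, so that list positions are
  variable indices and a list embedding yields a renaming.\<close>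

definition counts_list :: "code \<Rightarrow> (nat \<times> nat \<times> nat) list" where
  "counts_list m = map (counts m) [0..<code_bound m]"

text \<open>Injectivity prevents multiplicities of different elements from adding up in the
  image.\<close>

lemma image_mset_subseteq_if_counts:
  assumes "inj \<phi>" "\<And>i. count a i \<le> count b (\<phi> i)"
  shows "image_mset \<phi> a \<subseteq># b"
proof (rule mset_subset_eqI)
  fix x show "count (image_mset \<phi> a) x \<le> count b x"
  proof (cases "x \<in> range \<phi>")
    case True
    then obtain i where "x = \<phi> i" by blast
    moreover have "count (image_mset \<phi> a) (\<phi> i) = count a i"
      using assms(1) by (induction a) (simp_all add: inj_eq)
    ultimately show ?thesis using assms(2) by simp
  next
    case False
    then have "count (image_mset \<phi> a) x = 0" by (auto simp: count_eq_zero_iff)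
    then show ?thesis by simp
  qed
qed

text \<open>The index map of the list embedding gives multiset inclusions, and the set differences
  supply the prefix. For words the two odd multisets differ in size by at most one in a fixed
  direction, so agreement on whether they are equal in size balances the prefix.\<close>

lemma code_emb_if_list_emb:
  assumes m: "m \<in> range code" "m' \<in> range code"
    and eq: "(size (fst (snd m)) = size (snd (snd m))) = (size (fst (snd m')) = size (snd (snd m')))"
    and emb: "list_emb counts_le (counts_list m) (counts_list m')"
  shows "code_emb m m'"
proof -
  obtain a b c a' b' c' where abc: "m = (a, b, c)" "m' = (a', b', c')"
    by (cases m, cases m') blast
  obtain \<phi> :: "nat \<Rightarrow> nat" where \<phi>: "strict_mono \<phi>"
    "\<And>i. i < code_bound m \<Longrightarrow> \<phi> i < code_bound m' \<and>
      counts_le (counts_list m ! i) (counts_list m' ! \<phi> i)"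
    using list_emb_imp_index_map[OF emb] by (auto simp: counts_list_def)
  have "counts_le (counts m i) (counts m' (\<phi> i))" for i
  proof (cases "i < code_bound m")
    case True then show ?thesis using \<phi>(2)[OF True] by (auto simp: counts_list_def)
  next
    \<comment> \<open>Past the bound all counts are zero, so every value of \<phi> is
      suitable.\<close>
    case False then show ?thesis using counts_beyond_bound[of m i] by (simp add: counts_le_def)
  qed
  then have "count a i \<le> count a' (\<phi> i)" "count b i \<le> count b' (\<phi> i)"
    "count c i \<le> count c' (\<phi> i)" for i by (auto simp: abc counts_le_def)
  then have sub: "image_mset \<phi> a \<subseteq># a'" "image_mset \<phi> b \<subseteq># b'" "image_mset \<phi> c \<subseteq># c'"
    using strict_mono_imp_inj_on[OF \<phi>(1)] by (auto intro: image_mset_subseteq_if_counts)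
  have "size b = size c \<or> size b = Suc (size c)" "size b' = size c' \<or> size b' = Suc (size c')"
    using m size_zodd by (auto simp: abc code_def)
  with eq sub(2,3)[THEN size_mset_mono]
  have "size (b' - image_mset \<phi> b) = size (c' - image_mset \<phi> c)"
    by (auto simp: abc size_Diff_submset[OF sub(2)] size_Diff_submset[OF sub(3)])
  moreover have "m' = shift \<phi> (a' - image_mset \<phi> a, b' - image_mset \<phi> b, c' - image_mset \<phi> c) m"
    using sub by (simp add: abc)
  ultimately show ?thesis using \<phi>(1) unfolding code_emb_def by blast
qed

lemma code_emb_wqo:
  fixes s :: "nat \<Rightarrow> code"
  assumes "\<And>n. s n \<in> range code"
  shows "\<exists>k :: nat \<Rightarrow> nat. strict_mono k \<and> (\<forall>i j. i < j \<longrightarrow> code_emb (s (k i)) (s (k j)))"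
proof -
  have "transp counts_le" by (rule transpI) (auto simp: counts_le_def)
  then have "wqo (list_emb counts_le)" using wqo_counts_le by (intro wqo_list_emb)
  from wqoD[OF wqo_both[OF wqo_eq_bool this,
        of "\<lambda>m :: code. size (fst (snd m)) = size (snd (snd m))" counts_list], of s]
  obtain k :: "nat \<Rightarrow> nat" where "strict_mono k"
    and k: "\<forall>i j. i < j \<longrightarrow>
      (size (fst (snd (s (k i)))) = size (snd (snd (s (k i))))) =
      (size (fst (snd (s (k j)))) = size (snd (snd (s (k j))))) \<and>
      list_emb counts_le (counts_list (s (k i))) (counts_list (s (k j)))"
    by (elim exE conjE)
  moreover have "code_emb (s (k i)) (s (k j))" if "i < j" for i j
    using k that assms by (intro code_emb_if_list_emb) auto
  ultimately show ?thesis by blast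
qed

section \<open>Reduction by leading terms\<close>

lemma finite_nf_coeff_support:
  assumes "f \<in> fpolys"
  shows "finite {m. nf_coeff f m \<noteq> 0}"
proof (rule finite_subset)
  show "{m. nf_coeff f m \<noteq> 0} \<subseteq> code ` {w. f w \<noteq> 0}" by (blast elim: nf_coeff_nonzero)
  show "finite (code ` {w. f w \<noteq> 0})" using assms by (simp add: fpolys_def)
qed

definition leading :: "(var list \<Rightarrow> 'd::comm_ring_1) \<Rightarrow> code \<Rightarrow> bool" where
  "leading f m \<longleftrightarrow> nf_coeff f m \<noteq> 0 \<and> (\<forall>n>m. nf_coeff f n = 0)"

lemma ex_leading:
  assumes "f \<in> fpolys" "nf_coeff f n \<noteq> 0"
  shows "\<exists>m. leading f m"
proof -
  let ?A = "{m. nf_coeff f m \<noteq> 0}"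
  have A: "finite ?A" "?A \<noteq> {}" using finite_nf_coeff_support[OF assms(1)] assms(2) by blast+
  have "Max ?A \<in> ?A" using A by (rule Max_in)
  moreover have "nf_coeff f n = 0" if "n > Max ?A" for n
    using Max_ge[OF A(1), of n] that by (meson leD mem_Collect_eq)
  ultimately show ?thesis unfolding leading_def by blast
qed

text \<open>Some element of \<open>K\<close> has the same coefficient as \<open>f\<close> at the
  leading code and none above. Subtracting it stays in \<open>J\<close> and lowers the leading code
  or kills all coefficients; codes are well-ordered, so this reduction ends in
  \<open>K\<close>.\<close>

lemma (in sl2_identities) mem_if_leading_coeffs_generated:
  assumes J: "wT_ideal J" "K \<subseteq> J"
    and gen: "\<And>f m. f \<in> J \<Longrightarrow> leading f m \<Longrightarrow>
      nf_coeff f m \<in> ideal_span {nf_coeff g n | g n. g \<in> K \<and> leading g n \<and> code_emb n m}"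
    and f: "f \<in> J"
  shows "f \<in> K"
proof -
  have main: "f \<in> K" if "f \<in> J" "leading f m" for f m
    using that
  proof (induction m arbitrary: f rule: less_induct)
    case (less m)
    \<comment> \<open>Each generator is a leading coefficient at a code embedding into
      \<open>m\<close>; \<open>wT_ideal_code_emb\<close> moves it to \<open>m\<close> without
      creating larger codes, and linear combinations follow by induction.\<close>
    have "\<exists>g\<in>K. nf_coeff g m = x \<and> (\<forall>n>m. nf_coeff g n = 0)"
      if "x \<in> ideal_span {nf_coeff g n | g n. g \<in> K \<and> leading g n \<and> code_emb n m}" for x
      using that
    proof induction
      case span_zero
      then show ?case using wT_ideal_pzero[OF wT_ideal] nf_coeff_pzero by blast
    next
      case (span_step c x r)
      then obtain g n where "g \<in> K" "leading g n" "code_emb n m" "c = nf_coeff g n" by blast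
      then obtain g' where "g' \<in> K" "nf_coeff g' m = c" "\<And>n. n > m \<Longrightarrow> nf_coeff g' n = 0"
        using wT_ideal_code_emb[OF wT_ideal, of g n m] unfolding leading_def by metis
      moreover obtain h where "h \<in> K" "nf_coeff h m = x" "\<And>n. n > m \<Longrightarrow> nf_coeff h n = 0"
        using span_step by blast
      ultimately show ?case
        by (intro bexI[of _ "padd (psmult r g') h"])
          (simp_all add: nf_coeff_padd nf_coeff_psmult wT_ideal_padd wT_ideal_psmult wT_ideal)
    qed
    from this[OF gen[OF less.prems]] obtain g where g: "g \<in> K" "nf_coeff g m = nf_coeff f m"
      "\<And>n. n > m \<Longrightarrow> nf_coeff g n = 0" by blast
    define d where "d = psub f g"
    have d: "d \<in> J" using less.prems g(1) J by (auto simp: d_def intro: wT_ideal_psub)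
    have small: "n < m" if "nf_coeff d n \<noteq> 0" for n
      using that g less.prems(2) by (metis d_def nf_coeff_psub leading_def diff_self linorder_neqE)
    have "d \<in> K"
    proof (cases "\<exists>n. nf_coeff d n \<noteq> 0")
      case True
      then obtain n where "leading d n" using ex_leading wT_ideal_fpolys[OF J(1) d] by blast
      moreover from this have "n < m" by (intro small) (simp add: leading_def)
      ultimately show ?thesis using less.IH d by blast
    next
      case False
      then show ?thesis using mem_if_nf_coeff_zero wT_ideal_fpolys[OF J(1) d] by blast
    qed
    then have "padd d g \<in> K" using g wT_ideal by (intro wT_ideal_padd)
    then show "f \<in> K" by (simp add: d_def padd_def psub_def)
  qed
  show ?thesis
  proof (cases "\<exists>n. nf_coeff f n \<noteq> 0")
    case True
    then show ?thesis using ex_leading wT_ideal_fpolys[OF J(1) f] main f by blast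
  next
    case False
    then show ?thesis using mem_if_nf_coeff_zero wT_ideal_fpolys[OF J(1) f] by blast
  qed
qed

theorem mainTheorem16:
  fixes J :: "(var list \<Rightarrow> 'd::idom) set"
  assumes "infinite (UNIV :: 'd set)"
    and "noetherian TYPE('d)"
    and "wT_ideal J"
    and "wT_gen sl2_gens \<subseteq> J"
  shows "\<exists>S. finite S \<and> S \<subseteq> J \<and> J = wT_gen S"
proof -
  define X where "X = {(m, nf_coeff f m) | f m. f \<in> J \<and> leading f m}"
  \<comment> \<open>Leading codes must come from words, since \<open>code_emb_wqo\<close> rests on
    the size constraint of such codes.\<close>
  have X_codes: "fst ` X \<subseteq> range code"
  proof
    fix m assume "m \<in> fst ` X"
    then obtain f :: "var list \<Rightarrow> 'd" where "leading f m" unfolding X_def by fastforce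
    then show "m \<in> range code" unfolding leading_def by (blast elim: nf_coeff_nonzero)
  qed
  have "\<exists>F. finite F \<and> F \<subseteq> X \<and>
      (\<forall>p\<in>X. snd p \<in> ideal_span {c'. \<exists>m'. (m', c') \<in> F \<and> code_emb m' (fst p)})"
    using assms(2)
  proof (rule noetherian_finite_lead_basis)
    fix s :: "nat \<Rightarrow> code"
    assume "\<And>n. s n \<in> fst ` X"
    then have "\<And>n. s n \<in> range code" using X_codes by blast
    then show "\<exists>k :: nat \<Rightarrow> nat. strict_mono k \<and> (\<forall>i j. i < j \<longrightarrow> code_emb (s (k i)) (s (k j)))"
      by (rule code_emb_wqo)
  qed
  then obtain F where F: "finite F" "F \<subseteq> X"
    "\<forall>p\<in>X. snd p \<in> ideal_span {c'. \<exists>m'. (m', c') \<in> F \<and> code_emb m' (fst p)}"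
    by blast
  have "\<forall>p\<in>F. \<exists>f\<in>J. leading f (fst p) \<and> nf_coeff f (fst p) = snd p"
  proof
    fix p assume "p \<in> F"
    then have "p \<in> X" using F(2) by blast
    then obtain f m where "p = (m, nf_coeff f m)" "f \<in> J" "leading f m"
      unfolding X_def by blast
    then show "\<exists>f\<in>J. leading f (fst p) \<and> nf_coeff f (fst p) = snd p" by auto
  qed
  then obtain e where e: "\<And>p. p \<in> F \<Longrightarrow>
      e p \<in> J \<and> leading (e p) (fst p) \<and> nf_coeff (e p) (fst p) = snd p"
    by metis
  \<comment> \<open>The chosen elements of \<open>J\<close> supply the leading coefficients;
    adjoining the relations makes reduction to normal forms available inside
    \<open>wT_gen S\<close>.\<close>
  define S where "S = sl2_gens \<union> e ` F"
  have "finite S" using F(1) by (simp add: S_def sl2_gens_def)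
  have "S \<subseteq> J" using e assms(4) wT_gen_superset by (force simp: S_def)
  interpret K: sl2_identities "wT_gen S"
    using wT_ideal_wT_gen[OF assms(3) \<open>S \<subseteq> J\<close>] wT_gen_superset[of S]
    by unfold_locales (auto simp: S_def)
  have sub: "wT_gen S \<subseteq> J" using assms(3) \<open>S \<subseteq> J\<close> by (rule wT_gen_subset)
  have "f \<in> wT_gen S" if "f \<in> J" for f
  proof (rule K.mem_if_leading_coeffs_generated[OF assms(3) sub _ that])
    fix f m assume fm: "f \<in> J" "leading f m"
    then have "(m, nf_coeff f m) \<in> X" unfolding X_def by blast
    from F(3)[rule_format, OF this]
    have mem: "nf_coeff f m \<in> ideal_span {c'. \<exists>m'. (m', c') \<in> F \<and> code_emb m' m}"
      by simp
    have "{c'. \<exists>m'. (m', c') \<in> F \<and> code_emb m' m} \<subseteq>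
        {nf_coeff g n | g n. g \<in> wT_gen S \<and> leading g n \<and> code_emb n m}"
    proof
      fix c assume "c \<in> {c'. \<exists>m'. (m', c') \<in> F \<and> code_emb m' m}"
      then obtain n where n: "(n, c) \<in> F" "code_emb n m" by blast
      then have "e (n, c) \<in> wT_gen S" using wT_gen_superset[of S] by (auto simp: S_def)
      with n(2) e[OF n(1), unfolded fst_conv snd_conv] show
        "c \<in> {nf_coeff g n | g n. g \<in> wT_gen S \<and> leading g n \<and> code_emb n m}"
        by (intro CollectI exI[of _ "e (n, c)"] exI[of _ n]) simp
    qed
    then show "nf_coeff f m \<in>
        ideal_span {nf_coeff g n | g n. g \<in> wT_gen S \<and> leading g n \<and> code_emb n m}"
      using mem by (rule ideal_span_mono)
  qed
  with sub have "J = wT_gen S" by blast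
  with \<open>finite S\<close> \<open>S \<subseteq> J\<close> show ?thesis by blast
qed

end
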